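(* Let $r\ge 1$. The semistable chains of rank $r$ and degree $0$ are precisely the sequences of length $r$ of the form $$(0,\dots,0,1,0,\dots,0,-1,0,\dots,0,1,\dots\dots,-1,0,\dots,0,1,0,\dots,0),$$ i.e. the sequences with entries in $\{-1,0,1\}$ whose nonzero entries alternate between $1$ and $-1$, the first and the last nonzero entries being $1$, and where the zero-blocks are of arbitrary (possibly zero) lengths. If $r>1$, none of these chains is stable. If $r=1$, there is precisely one semistable chain of rank $1$ and degree $0$, namely $(1)$, and it is stable.
   Context: A chain is a finite (nonempty) sequence of integers. A subchain of a chain $(a_1,\dots,a_r)$ is a chain $(a_i,a_{i+1},\dots,a_j)$ with $1\le i\le j\le r$; it is proper if its length is less than $r$. For a chain $\mathbf a=(a_1,\dots,a_r)$: $\deg\mathbf a=\sum_{i=1}^r a_i-1$, rank $r$, slope $\mu(\mathbf a)=\deg\mathbf a/r$. A chain $\mathbf a$ is semistable if $\mu(\mathbf b)\le\mu(\mathbf a)$ for every subchain $\mathbf b$ of $\mathbf a$, and stable if moreover the inequality is strict for every proper subchain. *)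

theory Defs
  imports Complex_Main "HOL-Library.Sublist"
begin

definition is_chain :: "int list \<Rightarrow> bool" where
  "is_chain a \<longleftrightarrow> a \<noteq> []"

text \<open>The list-library notion \<open>sublist\<close> means a contiguous segment, but
  it admits the empty list, which is not a chain.\<close>

definition subchain :: "int list \<Rightarrow> int list \<Rightarrow> bool" where
  "subchain b a \<longleftrightarrow> is_chain b \<and> sublist b a"

definition proper_subchain :: "int list \<Rightarrow> int list \<Rightarrow> bool" where
  "proper_subchain b a \<longleftrightarrow> subchain b a \<and> length b < length a"

text \<open>The degree is \<open>(a\<^sub>1 + \<dots> + a\<^sub>r) - 1\<close>:
  1 is subtracted once, not from every entry.\<close>

definition chain_deg :: "int list \<Rightarrow> int" where
  "chain_deg a = sum_list a - 1"

definition chain_rank :: "int list \<Rightarrow> nat" where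
  "chain_rank a = length a"

definition slope :: "int list \<Rightarrow> rat" where
  "slope a = of_int (chain_deg a) / of_nat (chain_rank a)"

definition semistable_chain :: "int list \<Rightarrow> bool" where
  "semistable_chain a \<longleftrightarrow> is_chain a \<and> (\<forall>b. subchain b a \<longrightarrow> slope b \<le> slope a)"

definition stable_chain :: "int list \<Rightarrow> bool" where
  "stable_chain a \<longleftrightarrow> semistable_chain a \<and> (\<forall>b. proper_subchain b a \<longrightarrow> slope b < slope a)"

text \<open>The sequences \<open>(0,\<dots>,0,1,0,\<dots>,0,-1,0,\<dots>,0,1,\<dots>,-1,0,\<dots>,0,1,0,\<dots>,0)\<close>.
  There is at least one nonzero entry, since the first and the last nonzero
  entry are required to be 1; they may coincide.\<close>

definition alternating_seq :: "int list \<Rightarrow> bool" where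
  "alternating_seq a \<longleftrightarrow> set a \<subseteq> {-1, 0, 1} \<and>
     (let nz = filter (\<lambda>x. x \<noteq> 0) a in
        nz \<noteq> [] \<and> hd nz = 1 \<and> last nz = 1 \<and> successively (\<lambda>x y. y = - x) nz)"

end

theory Submission
  imports Defs
begin

text \<open>A chain has degree 0 and is semistable iff it has sum 1 and all its segments have sum at
  most 1. Reading such a chain from the left, a suffix sum is determined by the prefix before it, so
  bounds on prefixes and suffixes leave at each position only the entry 0 or the negative of the
  previous nonzero entry. An entry 1 is itself a subchain of slope 0, which excludes stability
  as soon as it is proper.\<close>

text \<open>Here \<open>s\<close> is the last nonzero entry read so far; initially \<open>s = -1\<close>, which makes the
  condition on prefixes redundant.\<close>

lemma alternating_after_iff_sums:
  fixes s :: int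
  assumes "s = 1 \<or> s = -1"
  shows "set xs \<subseteq> {-1, 0, 1}
      \<and> successively (\<lambda>x y. y = - x) (s # filter (\<lambda>x. x \<noteq> 0) xs)
      \<and> last (s # filter (\<lambda>x. x \<noteq> 0) xs) = 1
    \<longleftrightarrow> (\<forall>b. sublist b xs \<longrightarrow> sum_list b \<le> 1)
      \<and> (\<forall>p. prefix p xs \<longrightarrow> 2 * sum_list p \<le> 1 - s)
      \<and> 2 * sum_list xs = 1 - s"
    (is "?alt s xs \<longleftrightarrow> ?sums s xs")
  using assms
proof (induction xs arbitrary: s)
  case Nil
  then show ?case by auto
next
  case (Cons x xs)
  \<comment> \<open>An entry 0 keeps the last nonzero entry \<open>s\<close>, and an entry
    \<open>- s\<close> replaces it; alternation leaves no other choice.\<close>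
  have alt: "?alt s (x # xs) \<longleftrightarrow> x = 0 \<and> ?alt s xs \<or> x = - s \<and> ?alt (- s) xs"
    using Cons.prems by auto
  have pre: "(\<forall>p. prefix p (x # xs) \<longrightarrow> Q p) \<longleftrightarrow> Q [] \<and> (\<forall>p. prefix p xs \<longrightarrow> Q (x # p))" for Q
    by (auto simp: prefix_Cons)
  have sub: "(\<forall>b. sublist b (x # xs) \<longrightarrow> Q b)
      \<longleftrightarrow> (\<forall>p. prefix p (x # xs) \<longrightarrow> Q p) \<and> (\<forall>b. sublist b xs \<longrightarrow> Q b)" for Q
    by (auto simp: sublist_Cons_right)
  \<comment> \<open>Prefixes of \<open>x # xs\<close> are \<open>[]\<close> and
    \<open>x # p\<close>, so \<open>x\<close> moves to the right-hand side. The prefix and total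
    conditions become those for \<open>xs\<close> with \<open>s + 2 * x\<close> in place of
    \<open>s\<close>.\<close>
  have sums: "?sums s (x # xs) \<longleftrightarrow> (\<forall>b. sublist b xs \<longrightarrow> sum_list b \<le> 1)
      \<and> (\<forall>p. prefix p xs \<longrightarrow> 2 * sum_list p \<le> 1 - s - 2 * x)
      \<and> 2 * sum_list xs = 1 - s - 2 * x"
    (is "_ \<longleftrightarrow> ?rest")
  proof
    assume "?sums s (x # xs)"
    then show ?rest
      unfolding sub pre by (fastforce simp: algebra_simps)
  next
    assume rest: ?rest
    \<comment> \<open>The second bound yields the first, because 1 - s is at most 2.\<close>
    have prefixes: "x + sum_list p \<le> 1 \<and> 2 * (x + sum_list p) \<le> 1 - s" if "prefix p xs" for p
    proof -
      have "2 * sum_list p \<le> 1 - s - 2 * x"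
        using rest that by blast
      then show ?thesis
        using Cons.prems by auto
    qed
    then show "?sums s (x # xs)"
      unfolding sub pre using rest Cons.prems by auto
  qed
  \<comment> \<open>The empty prefix bounds \<open>x\<close> from above, and the segment
    \<open>xs\<close> itself bounds it from below: 2 * x lies between -1 - s and 1 - s.\<close>
  have range: "x = 0 \<or> x = - s" if ?rest
  proof -
    have "sum_list xs \<le> 1"
      using that by simp
    moreover have "0 \<le> 1 - s - 2 * x"
      using that[THEN conjunct2, THEN conjunct1, rule_format, of "[]"] by simp
    moreover have "2 * sum_list xs = 1 - s - 2 * x"
      using that by simp
    ultimately show ?thesis
      using Cons.prems by auto
  qed
  have "?sums s (x # xs) \<longleftrightarrow> x = 0 \<and> ?sums s xs \<or> x = - s \<and> ?sums (- s) xs"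
    unfolding sums
  proof (cases "x = 0 \<or> x = - s")
    \<comment> \<open>Here \<open>s + 2 * x\<close> is \<open>s\<close> or \<open>- s\<close>, so
      \<open>?rest\<close> is exactly one of the two alternatives; they exclude each other since
      \<open>s\<close> is nonzero.\<close>
    case True
    then show "?rest \<longleftrightarrow> x = 0 \<and> ?sums s xs \<or> x = - s \<and> ?sums (- s) xs"
      using Cons.prems by (elim disjE) simp_all
  next
    case False
    then show "?rest \<longleftrightarrow> x = 0 \<and> ?sums s xs \<or> x = - s \<and> ?sums (- s) xs"
      using range by blast
  qed
  moreover have "?alt s xs \<longleftrightarrow> ?sums s xs"
    using Cons.prems by (rule Cons.IH)
  moreover have "?alt (- s) xs \<longleftrightarrow> ?sums (- s) xs"
    by (rule Cons.IH) (use Cons.prems in auto)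
  ultimately show ?case
    unfolding alt by (simp only:)
qed

lemma alternating_seq_iff_sums:
  "alternating_seq a \<longleftrightarrow> sum_list a = 1 \<and> (\<forall>b. sublist b a \<longrightarrow> sum_list b \<le> 1)"
proof -
  let ?nz = "filter (\<lambda>x. x \<noteq> 0) a"
  \<comment> \<open>The artificial -1 in front forces the first nonzero entry to be 1, and a last
    entry 1 then rules out that \<open>?nz\<close> is empty.\<close>
  have "alternating_seq a \<longleftrightarrow> set a \<subseteq> {-1, 0, 1}
      \<and> successively (\<lambda>x y. y = - x) (-1 # ?nz) \<and> last (-1 # ?nz) = 1"
    unfolding alternating_seq_def Let_def successively_Cons by auto
  also have "\<dots> \<longleftrightarrow> sum_list a = 1 \<and> (\<forall>b. sublist b a \<longrightarrow> sum_list b \<le> 1)"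
    using alternating_after_iff_sums[of "-1" a] by (simp, blast)
  finally show ?thesis .
qed

lemma slope_le_0_iff: "is_chain b \<Longrightarrow> slope b \<le> 0 \<longleftrightarrow> sum_list b \<le> 1"
  by (simp add: is_chain_def slope_def chain_deg_def chain_rank_def divide_le_0_iff)

lemma semistable_deg_0_iff:
  "semistable_chain a \<and> chain_deg a = 0 \<longleftrightarrow> alternating_seq a"
proof -
  have "semistable_chain a \<longleftrightarrow> (\<forall>b. sublist b a \<longrightarrow> sum_list b \<le> 1)" if "sum_list a = 1"
  proof -
    have "slope a = 0"
      using that by (simp add: slope_def chain_deg_def)
    moreover have "a \<noteq> []"
      using that by auto
    ultimately have "semistable_chain a \<longleftrightarrow> (\<forall>b. b \<noteq> [] \<and> sublist b a \<longrightarrow> sum_list b \<le> 1)"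
      by (simp add: semistable_chain_def subchain_def is_chain_def slope_le_0_iff)
    \<comment> \<open>The empty segment is not a chain, but its sum 0 satisfies the bound
      anyway.\<close>
    also have "\<dots> \<longleftrightarrow> (\<forall>b. sublist b a \<longrightarrow> sum_list b \<le> 1)"
      by (metis sum_list.Nil zero_le_one)
    finally show ?thesis .
  qed
  then show ?thesis
    by (auto simp: alternating_seq_iff_sums chain_deg_def)
qed

text \<open>The first nonzero entry is a witness. It gives the subchain that excludes stability, and
  it determines the chain in rank 1.\<close>

lemma alternating_seq_1_in_set: "alternating_seq a \<Longrightarrow> 1 \<in> set a"
  unfolding alternating_seq_def Let_def by (metis filter_is_subset hd_in_set subsetD)

lemma not_stable_if_alternating:
  assumes "alternating_seq a" "length a > 1"
  shows "\<not> stable_chain a"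
proof -
  have "sublist [1] a"
    using alternating_seq_1_in_set[OF assms(1)] by (auto simp: sublist_def dest: split_list)
  then have "proper_subchain [1] a"
    using assms(2) by (simp add: proper_subchain_def subchain_def is_chain_def)
  moreover have "slope [1] = slope a"
    using assms(1) by (simp add: slope_def chain_deg_def alternating_seq_iff_sums)
  ultimately show ?thesis
    unfolding stable_chain_def by force
qed

lemma alternating_seq_length_1_iff: "length a = 1 \<and> alternating_seq a \<longleftrightarrow> a = [1]"
proof
  assume "length a = 1 \<and> alternating_seq a"
  then show "a = [1]"
    using alternating_seq_1_in_set[of a] by (auto simp: length_Suc_conv)
qed (simp add: alternating_seq_def)

lemma stable_chain_1: "stable_chain [1]"
proof -
  have "semistable_chain [1]"
    using semistable_deg_0_iff alternating_seq_length_1_iff by blast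
  \<comment> \<open>A proper subchain of \<open>[1]\<close> would have length 0, so strictness holds
    vacuously.\<close>
  then show ?thesis
    by (auto simp: stable_chain_def proper_subchain_def subchain_def is_chain_def)
qed

theorem proposition3p11:
  fixes r :: nat
  assumes "r \<ge> 1"
  shows "{a. semistable_chain a \<and> chain_rank a = r \<and> chain_deg a = 0}
           = {a. length a = r \<and> alternating_seq a}
    \<and> (r > 1 \<longrightarrow> (\<forall>a. semistable_chain a \<and> chain_rank a = r \<and> chain_deg a = 0 \<longrightarrow> \<not> stable_chain a))
    \<and> (r = 1 \<longrightarrow> {a. semistable_chain a \<and> chain_rank a = r \<and> chain_deg a = 0} = {[1]} \<and> stable_chain [1])"
proof -
  have iff: "semistable_chain a \<and> chain_rank a = r \<and> chain_deg a = 0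
      \<longleftrightarrow> length a = r \<and> alternating_seq a" for a
    using semistable_deg_0_iff[of a] by (auto simp: chain_rank_def)
  show ?thesis
    unfolding iff using not_stable_if_alternating alternating_seq_length_1_iff stable_chain_1 by auto
qed

end
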